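(* If, for some $\lambda\in(1/2,2/3)$, the invariant set $\mathcal{S}_\lambda$ is totally self-similar, then $\lambda=\omega_m$ for some integer $m\ge2$.
   Context: Let $\mathbf p_k=\frac23(\cos(2\pi k/3),\sin(2\pi k/3))\in\mathbb{R}^2$, $k=0,1,2$, and let $\Delta$ be the closed (filled) equilateral triangle with vertices $\mathbf p_0,\mathbf p_1,\mathbf p_2$. For $\lambda\in(0,1)$ let $f_i(\mathbf x)=\lambda\mathbf x+(1-\lambda)\mathbf p_i$, $i=0,1,2$. The invariant set $\mathcal{S}_\lambda$ is the unique non-empty compact set with $\mathcal{S}_\lambda=\bigcup_{i=0}^2 f_i(\mathcal{S}_\lambda)$. Put $\Sigma=\{0,1,2\}$ and, for $\boldsymbol\varepsilon=(\varepsilon_0,\dots,\varepsilon_{n-1})\in\Sigma^n$, $f_{\boldsymbol\varepsilon}=f_{\varepsilon_0}\circ\cdots\circ f_{\varepsilon_{n-1}}$. The set $\mathcal{S}_\lambda$ is called totally self-similar if $f_{\boldsymbol\varepsilon}(\mathcal{S}_\lambda)=f_{\boldsymbol\varepsilon}(\Delta)\cap\mathcal{S}_\lambda$ for every $n\ge1$ and every $\boldsymbol\varepsilon\in\Sigma^n$. For $m\ge2$ the multinacci number $\omega_m$ is the unique positive root of $x^m+x^{m-1}+\cdots+x=1$. *)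

theory Defs
  imports "HOL-Analysis.Analysis"
begin

definition vert :: "nat \<Rightarrow> real^2" where
  "vert k = (2/3) *\<^sub>R vector [cos (2 * pi * real k / 3), sin (2 * pi * real k / 3)]"

definition Tri :: "(real^2) set" where
  "Tri = convex hull {vert 0, vert 1, vert 2}"

definition fmap :: "real \<Rightarrow> nat \<Rightarrow> real^2 \<Rightarrow> real^2" where
  "fmap lam i x = lam *\<^sub>R x + (1 - lam) *\<^sub>R vert i"

definition Alphabet :: "nat set" where
  "Alphabet = {0, 1, 2}"

definition is_invariant_set :: "real \<Rightarrow> (real^2) set \<Rightarrow> bool" where
  "is_invariant_set lam S \<longleftrightarrow>
     S \<noteq> {} \<and> compact S \<and> S = (\<Union>i\<in>Alphabet. fmap lam i ` S)"

text \<open>The description below is proper for \<open>0 < lam < 1\<close>; see \<open>ex1_invariant_set\<close>.\<close>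

definition invariant_set :: "real \<Rightarrow> (real^2) set" where
  "invariant_set lam = (THE S. is_invariant_set lam S)"

text \<open>For a word \<open>[e0, ..., en]\<close> this is \<open>f e0 \<circ> ... \<circ> f en\<close>: the first letter is applied last.\<close>

definition fword :: "real \<Rightarrow> nat list \<Rightarrow> real^2 \<Rightarrow> real^2" where
  "fword lam w = foldr (\<lambda>i g. fmap lam i \<circ> g) w id"

definition totally_self_similar :: "real \<Rightarrow> bool" where
  "totally_self_similar lam \<longleftrightarrow>
     (\<forall>n\<ge>1. \<forall>w. length w = n \<and> set w \<subseteq> Alphabet \<longrightarrow>
        fword lam w ` invariant_set lam = fword lam w ` Tri \<inter> invariant_set lam)"

text \<open>The description below is proper for \<open>m \<ge> 1\<close>; see \<open>ex1_multinacci\<close>.\<close>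

definition multinacci :: "nat \<Rightarrow> real" where
  "multinacci m = (THE x. 0 < x \<and> (\<Sum>k=1..m. x ^ k) = 1)"

lemma ex1_multinacci:
  assumes "m \<ge> 1"
  shows "\<exists>!x::real. 0 < x \<and> (\<Sum>k=1..m. x ^ k) = 1"
proof -
  let ?g = "\<lambda>x::real. \<Sum>k=1..m. x ^ k"
  have mono: "?g x < ?g y" if "0 < x" "x < y" for x y
    using that assms by (intro sum_strict_mono) (auto intro!: power_strict_mono)
  have "\<exists>x\<ge>0. x \<le> 1 \<and> ?g x = 1"
  proof (rule IVT')
    show "?g 0 \<le> 1" by (simp add: power_0_left)
    show "1 \<le> ?g 1" using assms by simp
    show "continuous_on {0..1} ?g" by (intro continuous_intros)
  qed simp
  then obtain x where x: "x \<ge> 0" "?g x = 1" by blast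
  then have "x > 0" by (cases "x = 0") (auto simp: power_0_left)
  show ?thesis
  proof (rule ex1I)
    show "0 < x \<and> ?g x = 1" using x \<open>x > 0\<close> by simp
    show "y = x" if "0 < y \<and> ?g y = 1" for y
      using mono[of x y] mono[of y x] x \<open>x > 0\<close> that by (cases x y rule: linorder_cases) auto
  qed
qed

lemma invariant_set_subset:
  assumes lam: "0 < lam" "lam < 1"
    and S: "is_invariant_set lam S" and T: "is_invariant_set lam T"
  shows "S \<subseteq> T"
proof -
  have T': "T \<noteq> {}" "closed T" "T = (\<Union>i\<in>Alphabet. fmap lam i ` T)"
    and S': "S \<noteq> {}" "compact S" "S = (\<Union>i\<in>Alphabet. fmap lam i ` S)"
    using S T by (auto simp: is_invariant_set_def compact_imp_closed)
  have "continuous_on S (\<lambda>x. infdist x T)" by (intro continuous_intros)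
  then obtain s where s: "s \<in> S" "\<And>y. y \<in> S \<Longrightarrow> infdist y T \<le> infdist s T"
    using continuous_attains_sup[OF S'(2,1)] by blast
  from s(1) have "s \<in> (\<Union>i\<in>Alphabet. fmap lam i ` S)" using S'(3) by blast
  then obtain i s' where i: "i \<in> Alphabet" "s' \<in> S" "s = fmap lam i s'" by auto
  obtain t where t: "t \<in> T" "infdist s' T = dist s' t"
    using infdist_attains_inf[OF T'(2,1)] by blast
  have "fmap lam i t \<in> T" using T'(3) t(1) i(1) by blast
  then have "infdist s T \<le> dist s (fmap lam i t)" by (rule infdist_le)
  also have "\<dots> = lam * dist s' t"
    using lam i(3) by (simp add: fmap_def dist_norm flip: scaleR_diff_right)
  also have "\<dots> \<le> lam * infdist s T" using s(2)[OF i(2)] t(2) lam by simp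
  finally have "(1 - lam) * infdist s T \<le> 0" by (simp add: algebra_simps)
  then have "infdist s T \<le> 0" using lam by (simp add: mult_le_0_iff)
  then have "infdist y T = 0" if "y \<in> S" for y
    using s(2)[OF that] infdist_nonneg[of y T] by linarith
  then show ?thesis using in_closed_iff_infdist_zero[OF T'(2,1)] by blast
qed

lemma ex1_invariant_set:
  assumes lam: "0 < lam" "lam < 1"
  shows "\<exists>!S. is_invariant_set lam S"
proof -
  define F where "F S = (\<Union>i\<in>Alphabet. fmap lam i ` S)" for S
  define A where "A n = (F ^^ n) Tri" for n
  define K where "K = (\<Inter>n. A n)"
  have F_mono: "F S \<subseteq> F T" if "S \<subseteq> T" for S T using that unfolding F_def by blast
  have F_cpt: "compact (F S)" if "compact S" for S
    unfolding F_def Alphabet_def fmap_def using that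
    by (intro compact_UN compact_continuous_image continuous_intros) auto
  have vert: "vert i \<in> Tri" if "i \<in> Alphabet" for i
    using that unfolding Tri_def Alphabet_def by (auto intro: hull_inc)
  have F_Tri: "F Tri \<subseteq> Tri"
  proof -
    have "convex Tri" by (simp add: Tri_def)
    then have "fmap lam i x \<in> Tri" if "i \<in> Alphabet" "x \<in> Tri" for i x
      using convexD[of Tri x "vert i" lam "1 - lam"] vert that lam by (simp add: fmap_def)
    then show ?thesis by (auto simp: F_def)
  qed
  have A_Suc: "A (Suc n) = F (A n)" for n by (simp add: A_def)
  have A_dec: "A (Suc n) \<subseteq> A n" for n
    by (induction n) (use F_Tri F_mono in \<open>auto simp: A_def\<close>)
  have A_anti: "A n \<subseteq> A m" if "m \<le> n" for m n
    using lift_Suc_antimono_le[of A] A_dec that by blast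
  have A_cpt: "compact (A n)" for n
    by (induction n) (auto simp: A_def Tri_def F_cpt compact_convex_hull)
  have A_ne: "A n \<noteq> {}" for n
    by (induction n) (auto simp: A_def Tri_def F_def Alphabet_def)
  have K_ne: "K \<noteq> {}"
    unfolding K_def using A_cpt A_ne A_anti by (rule compact_nest)
  have K_cpt: "compact K"
    unfolding K_def by (rule compact_Inter) (use A_cpt in auto)
  have K_F: "K \<subseteq> F K"
  proof
    fix x assume x: "x \<in> K"
    show "x \<in> F K"
    proof (rule ccontr)
      assume nx: "x \<notin> F K"
      have inj: "inj (fmap lam i)" for i using lam by (simp add: fmap_def inj_on_def)
      have "\<exists>n. x \<notin> fmap lam i ` A n" if "i \<in> Alphabet" for i
        using nx that image_INT[OF inj[of i], of UNIV A] by (auto simp: F_def K_def inj_on_def)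
      then obtain N where N: "\<And>i. i \<in> Alphabet \<Longrightarrow> x \<notin> fmap lam i ` A (N i)" by metis
      define M where "M = Max (N ` Alphabet)"
      have "N i \<le> M" if "i \<in> Alphabet" for i
        using that unfolding M_def Alphabet_def by (intro Max_ge) auto
      then have "x \<notin> F (A M)" using N A_anti unfolding F_def by blast
      moreover have "x \<in> A (Suc M)" using x by (auto simp: K_def)
      ultimately show False by (simp add: A_Suc)
    qed
  qed
  have "F K \<subseteq> A n" for n
  proof -
    have "F K \<subseteq> F (A n)" by (rule F_mono) (auto simp: K_def)
    then show ?thesis using A_dec[of n] by (simp add: A_Suc)
  qed
  then have "F K = K" using K_F by (auto simp: K_def)
  then have "is_invariant_set lam K"
    using K_ne K_cpt by (simp add: is_invariant_set_def F_def)
  then show ?thesis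
    using invariant_set_subset[OF lam] by blast
qed

end

theory Submission
  imports Defs
begin

text \<open>
  Write \<open>S\<close> for the invariant set and \<open>f i\<close> for the contractions.  In barycentric coordinates
  \<open>f i\<close> multiplies by \<open>lam\<close> and adds \<open>1 - lam\<close> to the coordinate \<open>i\<close>.  Hence every point of
  \<open>S\<close> has a coordinate that is at least \<open>1 - lam\<close>, and \<open>S\<close> misses the central hole, where all
  three are smaller.  If \<open>S\<close> is totally self-similar, it also misses the image of the central
  hole under every word (\<open>hole_images_disjoint\<close>).  The proof shows that some image of the hole
  meets \<open>S\<close> unless \<open>lam\<close> is multinacci.

  The triangles \<open>f 0 (Tri)\<close> and \<open>f 1 (Tri)\<close> overlap in a triangle of relative size
  \<open>2 * lam - 1\<close>.  The copies of \<open>Tri\<close> at the two ends of its base, under the words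
  \<open>0 1 ... 1\<close> and \<open>1 0 ... 0\<close>, have the sizes \<open>lam ^ j\<close>.  The overlap coincides with one of
  these copies exactly if \<open>2 * lam - 1 = lam ^ (m + 1)\<close>, which says that
  \<open>lam + ... + lam ^ m = 1\<close>.  Otherwise \<open>lam ^ (k + 1) < 2 * lam - 1 < lam ^ k\<close> for some
  \<open>k \<ge> 2\<close>, and the grids of the two families of copies do not match.  Let \<open>T\<close> be the copy of
  size \<open>lam ^ k\<close> under \<open>0 1 ... 1\<close>; it contains the overlap, which shares a
  corner with it.  As \<open>lam > 1/2\<close>, the edges of \<open>Tri\<close> lie in \<open>S\<close>, and so do the edges of
  all copies.

  If the overlap is large in \<open>T\<close>, the inner edge of the copy of size \<open>lam ^ (k + 1)\<close> under
  \<open>1 0 ... 0\<close> runs through the hole of \<open>T\<close> (\<open>inner_edge_crosses_hole\<close>).  If the overlap is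
  small in \<open>T\<close>, the edge that bounds it does so (\<open>boundary_edge_crosses_hole\<close>).  Both fail only
  if \<open>k = 2\<close> and \<open>2 * lam\<^sup>2 * (1 - lam) \<le> 2 * lam - 1\<close>.  Then the hole of \<open>T\<close> lies
  wholly inside the overlap, and \<open>f 1 (S)\<close> fills it.  To see this, remove from \<open>Tri\<close> only the
  central hole and its images under the iterates of a single \<open>f i\<close>.  A point of what remains
  has a preimage in what remains, hence belongs to \<open>S\<close>
  (\<open>off_corner_holes_subset_invariant_set\<close>), and the centre of the hole of \<open>T\<close> is such a point
  (\<open>covered_hole\<close>).
\<close>

section \<open>Barycentric coordinates\<close>

text \<open>The vertices sum to \<open>0\<close> and have the inner products \<open>4/9\<close> and \<open>-2/9\<close>, so this affine
  function is \<open>1\<close> at the vertex \<open>i\<close> and \<open>0\<close> at the other two.\<close>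

definition bary :: "nat \<Rightarrow> real^2 \<Rightarrow> real" where
  "bary i p = 1/3 + 3/2 * (p \<bullet> vert i)"

lemma vert_eq:
  "vert 0 = vector [2/3, 0]"
  "vert (Suc 0) = vector [-1/3, sqrt 3 / 3]"
  "vert 2 = vector [-1/3, - sqrt 3 / 3]"
proof -
  have "cos (2 * pi * 2 / 3) = cos (pi + pi / 3)" "sin (2 * pi * 2 / 3) = sin (pi + pi / 3)"
    by (auto intro!: arg_cong[where f = cos] arg_cong[where f = sin])
  then have "cos (2 * pi * 2 / 3) = - 1/2" "sin (2 * pi * 2 / 3) = - sqrt 3 / 2"
    by (simp_all only: cos_periodic_pi2 sin_periodic_pi2 cos_60 sin_60)
  then show "vert 0 = vector [2/3, 0]"
    "vert (Suc 0) = vector [-1/3, sqrt 3 / 3]"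
    "vert 2 = vector [-1/3, - sqrt 3 / 3]"
    by (simp_all add: vert_def vec_eq_iff forall_2 cos_120 sin_120)
qed

lemma inner_vert:
  assumes "i \<in> Alphabet" "j \<in> Alphabet"
  shows "vert i \<bullet> vert j = (if i = j then 4/9 else -2/9)"
  using assms by (auto simp: Alphabet_def vert_eq inner_vec_def sum_2)

lemma bary_vert:
  assumes "i \<in> Alphabet" "j \<in> Alphabet"
  shows "bary i (vert j) = (if i = j then 1 else 0)"
  using assms by (simp add: bary_def inner_vert)

lemma sum_bary: "bary 0 p + bary 1 p + bary 2 p = 1"
  by (simp add: bary_def vert_eq inner_vec_def sum_2 algebra_simps)

lemma bary_affine: "bary i (u *\<^sub>R p + (1 - u) *\<^sub>R q) = u * bary i p + (1 - u) * bary i q"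
  unfolding bary_def inner_add_left inner_scaleR_left by (simp add: field_simps)

lemma bary_eqI:
  assumes "bary 0 p = bary 0 q" "bary 1 p = bary 1 q"
  shows "p = q"
  using assms by (simp add: bary_def vert_eq inner_vec_def sum_2 vec_eq_iff forall_2 algebra_simps)

lemma bary_combination:
  assumes "a + b + c = 1"
  defines "p \<equiv> a *\<^sub>R vert 0 + b *\<^sub>R vert 1 + c *\<^sub>R vert 2"
  shows "bary 0 p = a" "bary 1 p = b" "bary 2 p = c"
proof -
  have c: "c = 1 - a - b" using assms by simp
  have bary: "bary i p = 1/3
      + 3/2 * (a * (vert 0 \<bullet> vert i) + b * (vert 1 \<bullet> vert i) + c * (vert 2 \<bullet> vert i))" for i
    by (simp add: bary_def p_def inner_add_left)
  show "bary 0 p = a" "bary 1 p = b" "bary 2 p = c"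
    unfolding bary by (simp_all add: inner_vert Alphabet_def c field_simps)
qed

lemma obtain_bary:
  fixes a b c :: real
  assumes "a + b + c = 1"
  obtains p where "bary 0 p = a" "bary 1 p = b" "bary 2 p = c"
  using bary_combination[OF assms] by blast

lemma mem_TriI:
  assumes "bary 0 p \<ge> 0" "bary 1 p \<ge> 0" "bary 2 p \<ge> 0"
  shows "p \<in> Tri"
proof -
  let ?q = "bary 0 p *\<^sub>R vert 0 + bary 1 p *\<^sub>R vert 1 + bary 2 p *\<^sub>R vert 2"
  have "p = ?q"
    by (rule bary_eqI) (simp_all only: bary_combination[OF sum_bary])
  moreover have "?q \<in> Tri"
    unfolding Tri_def convex_hull_3 using assms sum_bary[of p] by blast
  ultimately show ?thesis by simp
qed

lemma fmap_funpow: "(fmap lam i ^^ n) p = lam ^ n *\<^sub>R p + (1 - lam ^ n) *\<^sub>R vert i"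
proof (induction n)
  case (Suc n)
  then have "(fmap lam i ^^ Suc n) p = fmap lam i (lam ^ n *\<^sub>R p + (1 - lam ^ n) *\<^sub>R vert i)"
    by simp
  also have "\<dots> = lam ^ Suc n *\<^sub>R p + (1 - lam ^ Suc n) *\<^sub>R vert i"
    by (simp add: fmap_def algebra_simps)
  finally show ?case .
qed simp

lemma bary_fmap_funpow:
  assumes "i \<in> Alphabet" "j \<in> Alphabet"
  shows "bary i ((fmap lam j ^^ n) p)
    = lam ^ n * bary i p + (if i = j then 1 - lam ^ n else 0)"
  using bary_vert[OF assms] by (simp add: fmap_funpow bary_affine)

lemma bary_fmap:
  assumes "i \<in> Alphabet" "j \<in> Alphabet"
  shows "bary i (fmap lam j p) = lam * bary i p + (if i = j then 1 - lam else 0)"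
  using bary_fmap_funpow[OF assms, where n = 1] by simp

lemma obtain_preimage:
  assumes "lam \<noteq> 0" "i \<in> Alphabet"
  obtains q where "p = fmap lam i q"
    "\<And>j. j \<in> Alphabet \<Longrightarrow> bary j q = (bary j p - (if j = i then 1 - lam else 0)) / lam"
proof -
  define q where "q = (1 / lam) *\<^sub>R (p - (1 - lam) *\<^sub>R vert i)"
  have q: "p = fmap lam i q" using assms(1) by (simp add: q_def fmap_def)
  show ?thesis
    by (rule that[OF q]) (use bary_fmap[OF _ assms(2), of _ lam q] q assms(1) in auto)
qed

lemma fword_simps [simp]:
  "fword lam [] = id" "fword lam (i # w) = fmap lam i \<circ> fword lam w"
  by (simp_all add: fword_def)

lemma fword_replicate: "fword lam (replicate n i) = fmap lam i ^^ n"
  by (induction n) (simp_all add: fword_def)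

lemma inj_fword:
  assumes "lam \<noteq> 0"
  shows "inj (fword lam w)"
proof (induction w)
  case (Cons i w)
  have "inj (fmap lam i)" using assms by (simp add: inj_def fmap_def)
  then show ?case using Cons by (metis fword_simps(2) inj_compose)
qed (simp add: fword_def)

section \<open>Points inside and outside the invariant set\<close>

lemma is_invariant_invariant_set:
  assumes "0 < lam" "lam < 1"
  shows "is_invariant_set lam (invariant_set lam)"
  unfolding invariant_set_def by (rule theI'[OF ex1_invariant_set[OF assms]])

lemma fmap_invariant_set:
  assumes "is_invariant_set lam S" "i \<in> Alphabet" "p \<in> S"
  shows "fmap lam i p \<in> S"
  using assms unfolding is_invariant_set_def by blast

lemma fmap_funpow_invariant_set:
  assumes "is_invariant_set lam S" "i \<in> Alphabet" "p \<in> S"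
  shows "(fmap lam i ^^ n) p \<in> S"
  using assms by (induction n) (simp_all add: fmap_invariant_set)

text \<open>Distances to \<open>S\<close> shrink by \<open>lam\<close> from a preimage to its image, so a point that has
  preimages of every order within a bounded set is at distance \<open>0\<close> from \<open>S\<close>.\<close>

lemma invariant_set_coinduct:
  assumes lam: "0 < lam" "lam < 1" and S: "is_invariant_set lam S" and "bounded X"
    and X: "\<And>x. x \<in> X \<Longrightarrow> \<exists>i\<in>Alphabet. \<exists>y\<in>X. x = fmap lam i y"
  shows "X \<subseteq> S"
proof
  fix x assume x: "x \<in> X"
  have S': "S \<noteq> {}" "closed S"
    using S by (auto simp: is_invariant_set_def compact_imp_closed)
  then obtain s where s: "s \<in> S" by blast
  obtain M where M: "\<And>y. y \<in> X \<Longrightarrow> dist s y \<le> M"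
    using \<open>bounded X\<close> bounded_any_center by metis
  have bound: "infdist y S \<le> lam ^ n * M" if "y \<in> X" for n y
    using that
  proof (induction n arbitrary: y)
    case 0
    then show ?case using infdist_le2[OF s] M[of y] by (simp add: dist_commute)
  next
    case (Suc n)
    obtain i z where iz: "i \<in> Alphabet" "z \<in> X" "y = fmap lam i z" using X[OF Suc.prems] by blast
    obtain t where t: "t \<in> S" "infdist z S = dist z t"
      using infdist_attains_inf[OF S'(2,1)] by blast
    have "infdist y S \<le> dist y (fmap lam i t)"
      by (rule infdist_le) (rule fmap_invariant_set[OF S iz(1) t(1)])
    also have "\<dots> = lam * dist z t"
      using lam iz(3) by (simp add: fmap_def dist_norm flip: scaleR_diff_right)
    also have "\<dots> \<le> lam * (lam ^ n * M)"
      using Suc.IH[OF iz(2)] t(2) lam by (intro mult_left_mono) auto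
    finally show ?case by (simp add: mult.assoc)
  qed
  have "(\<lambda>n. lam ^ n * M) \<longlonglongrightarrow> 0 * M"
    using lam by (intro tendsto_intros LIMSEQ_power_zero) auto
  then have "infdist x S \<le> 0 * M"
    by (rule LIMSEQ_le_const) (use bound[OF x] in auto)
  then have "infdist x S = 0" using infdist_nonneg[of x S] by simp
  then show "x \<in> S" using in_closed_iff_infdist_zero[OF S'(2,1)] by blast
qed

lemma bary_invariant_set_nonneg:
  assumes lam: "0 < lam" "lam < 1" and S: "is_invariant_set lam S"
    and i: "i \<in> Alphabet" and "p \<in> S"
  shows "bary i p \<ge> 0"
proof -
  have S': "S \<noteq> {}" "compact S" "S = (\<Union>i\<in>Alphabet. fmap lam i ` S)"
    using S by (auto simp: is_invariant_set_def)
  have "continuous_on S (bary i)" unfolding bary_def by (intro continuous_intros)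
  then obtain s where s: "s \<in> S" "\<And>y. y \<in> S \<Longrightarrow> bary i s \<le> bary i y"
    using continuous_attains_inf[OF S'(2,1)] by blast
  obtain j t where j: "j \<in> Alphabet" "t \<in> S" "s = fmap lam j t" using S'(3) s(1) by blast
  have "lam * bary i s \<le> lam * bary i t" using s(2)[OF j(2)] lam by simp
  also have "\<dots> \<le> bary i s" using bary_fmap[OF i j(1), of lam t] j(3) lam by auto
  finally have "0 \<le> (1 - lam) * bary i s" by (simp add: algebra_simps)
  then have "0 \<le> bary i s" using lam by (simp add: zero_le_mult_iff)
  then show ?thesis using s(2)[OF \<open>p \<in> S\<close>] by simp
qed

lemma central_hole_disjoint:
  assumes lam: "0 < lam" "lam < 1" and S: "is_invariant_set lam S"
    and hole: "\<And>i. i \<in> Alphabet \<Longrightarrow> bary i p < 1 - lam"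
  shows "p \<notin> S"
proof
  assume "p \<in> S"
  then obtain j t where j: "j \<in> Alphabet" "t \<in> S" "p = fmap lam j t"
    using S unfolding is_invariant_set_def by blast
  have "0 \<le> lam * bary j t"
    using bary_invariant_set_nonneg[OF lam S j(1,2)] lam by simp
  then show False using bary_fmap[OF j(1) j(1), of lam t] j(3) hole[OF j(1)] by simp
qed

text \<open>The parts of \<open>S\<close> that come from other words could enter an image of the central hole.
  Total self-similarity forbids it: \<open>S\<close> meets the image of \<open>Tri\<close> under a word only in the
  image of \<open>S\<close> under the same word.\<close>

lemma hole_images_disjoint:
  assumes lam: "0 < lam" "lam < 1" and tss: "totally_self_similar lam"
    and w: "w \<noteq> []" "set w \<subseteq> Alphabet"
    and nonneg: "bary 0 q \<ge> 0" "bary 1 q \<ge> 0" "bary 2 q \<ge> 0"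
    and hole: "bary 0 q < 1 - lam" "bary 1 q < 1 - lam" "bary 2 q < 1 - lam"
  shows "fword lam w q \<notin> invariant_set lam"
proof
  assume "fword lam w q \<in> invariant_set lam"
  moreover have "fword lam w ` invariant_set lam = fword lam w ` Tri \<inter> invariant_set lam"
    using tss w unfolding totally_self_similar_def by (metis One_nat_def Suc_leI length_greater_0_conv)
  ultimately have "fword lam w q \<in> fword lam w ` invariant_set lam"
    using mem_TriI[OF nonneg] by blast
  then have "q \<in> invariant_set lam"
    using inj_image_mem_iff[OF inj_fword, of lam w q "invariant_set lam"] lam by simp
  moreover have "q \<notin> invariant_set lam"
    by (rule central_hole_disjoint[OF lam is_invariant_invariant_set[OF lam]])
      (use hole in \<open>auto simp: Alphabet_def\<close>)
  ultimately show False by blast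
qed

lemma bounded_bary: "bounded {p. bary 0 p \<ge> 0 \<and> bary 1 p \<ge> 0 \<and> bary 2 p \<ge> 0}"
proof (rule bounded_subset)
  show "bounded Tri" unfolding Tri_def by (simp add: compact_imp_bounded compact_convex_hull)
qed (auto intro: mem_TriI)

text \<open>On an edge, one of the two coordinates that do not vanish is at least
  \<open>1/2 \<ge> 1 - lam\<close>: the two images of the edge under the contractions to its end points
  cover it.\<close>

lemma edge_subset_invariant_set:
  assumes lam: "1/2 < lam" "lam < 1" and S: "is_invariant_set lam S"
    and p: "bary 0 p \<ge> 0" "bary 1 p \<ge> 0" "bary 2 p \<ge> 0"
    and i: "i \<in> Alphabet" "bary i p = 0"
  shows "p \<in> S"
proof -
  let ?X = "{p. bary 0 p \<ge> 0 \<and> bary 1 p \<ge> 0 \<and> bary 2 p \<ge> 0 \<and> bary i p = 0}"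
  have "?X \<subseteq> S"
  proof (rule invariant_set_coinduct[OF _ lam(2) S])
    show "0 < lam" using lam by simp
    show "bounded ?X" by (rule bounded_subset[OF bounded_bary]) auto
    fix x assume x: "x \<in> ?X"
    then have "\<exists>j\<in>Alphabet. j \<noteq> i \<and> bary j x \<ge> 1 - lam"
      using sum_bary[of x] lam i(1) unfolding Alphabet_def by auto
    then obtain j where j: "j \<in> Alphabet" "j \<noteq> i" "bary j x \<ge> 1 - lam" by blast
    obtain y where y: "x = fmap lam j y"
      "\<And>k. k \<in> Alphabet \<Longrightarrow> bary k y = (bary k x - (if k = j then 1 - lam else 0)) / lam"
      using obtain_preimage[of lam j x] lam j(1) by auto
    have "0 \<le> bary k x" if "k \<in> Alphabet" for k
      using x that by (auto simp: Alphabet_def)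
    then have "bary k y \<ge> 0" if "k \<in> Alphabet" for k
      using that y(2)[OF that] j(3) lam by simp
    moreover have "bary i y = 0" using y(2)[OF i(1)] x j(2) by simp
    ultimately have "y \<in> ?X" by (auto simp: Alphabet_def)
    then show "\<exists>j\<in>Alphabet. \<exists>y\<in>?X. x = fmap lam j y" using j(1) y(1) by blast
  qed
  then show ?thesis using p i(2) by blast
qed

section \<open>Edges crossing holes\<close>

text \<open>The maps of the words \<open>0 1 ... 1\<close> (with \<open>k - 1\<close> letters \<open>1\<close>) and \<open>1 0 ... 0\<close> (with \<open>k\<close>
  letters \<open>0\<close>) are homotheties of ratio \<open>lam ^ k\<close> and \<open>lam ^ (k + 1)\<close>.  Let \<open>d\<close> be the size of
  the overlap measured in the copy \<open>T\<close> of \<open>Tri\<close> under the first word, so \<open>lam < d < 1\<close>.  In the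
  coordinates of \<open>T\<close> the edge of the second copy that faces away from its corner is the segment
  where the coordinate \<open>0\<close> equals \<open>d - lam\<close> and the coordinate \<open>1\<close> ranges from \<open>1 - d\<close> to
  \<open>1 - d + lam\<close>.  The point of this line with equal coordinates \<open>1\<close> and \<open>2\<close> is in the
  central hole if \<open>d > 3 * lam - 1\<close>.\<close>

lemma inner_edge_crosses_hole:
  assumes lam: "1/2 < lam" "lam < 2/3"
    and k: "k \<ge> 1" "lam ^ (k + 1) < 2 * lam - 1" "2 * lam - 1 < lam ^ k"
    and cross: "(3 * lam - 1) * lam ^ k < 2 * lam - 1"
  shows "\<not> totally_self_similar lam"
proof
  assume tss: "totally_self_similar lam"
  let ?S = "invariant_set lam"
  have lam': "0 < lam" "lam < 1" using lam by auto
  note S = is_invariant_invariant_set[OF lam']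
  define d where "d = (2 * lam - 1) / lam ^ k"
  have pos: "lam ^ k > 0" using lam by simp
  have d: "d * lam ^ k = 2 * lam - 1" unfolding d_def using pos by (metis less_irrefl nonzero_eq_divide_eq)
  have d': "lam < d" "d < 1" "3 * lam - 1 < d"
    unfolding d_def using k cross pos by (simp_all add: pos_less_divide_eq pos_divide_less_eq)
  obtain q where q: "bary 0 q = d - lam" "bary 1 q = (1 + lam - d) / 2" "bary 2 q = (1 + lam - d) / 2"
    by (rule obtain_bary[of "d - lam" "(1 + lam - d) / 2" "(1 + lam - d) / 2"]) auto
  \<comment> \<open>The coordinates of the same point with respect to the copy under \<open>1 0 ... 0\<close>.\<close>
  define e1 where "e1 = (lam + d - 1) / (2 * lam)"
  define e2 where "e2 = (1 + lam - d) / (2 * lam)"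
  have e12: "e1 + e2 = 1" "e1 \<ge> 0" "e2 \<ge> 0" using lam d' by (auto simp: e1_def e2_def field_simps)
  obtain e where e: "bary 0 e = 0" "bary 1 e = e1" "bary 2 e = e2"
    by (rule obtain_bary[of 0 e1 e2]) (use e12 in auto)
  have "e \<in> ?S"
    by (rule edge_subset_invariant_set[OF lam(1) lam'(2) S, where i = 0])
      (use e e12 in \<open>auto simp: Alphabet_def\<close>)
  then have "fmap lam 1 ((fmap lam 0 ^^ k) e) \<in> ?S"
    by (intro fmap_invariant_set[OF S] fmap_funpow_invariant_set[OF S]) (auto simp: Alphabet_def)
  moreover have "fmap lam 1 ((fmap lam 0 ^^ k) e) = fmap lam 0 ((fmap lam 1 ^^ (k - 1)) q)"
  proof (rule bary_eqI)
    have k': "lam ^ k = lam * lam ^ (k - 1)" using k(1) by (cases k) auto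
    have le: "lam * e1 = (lam + d - 1) / 2" using lam by (simp add: e1_def)
    have "bary 0 (fmap lam 1 ((fmap lam 0 ^^ k) e)) = lam - lam * lam ^ k"
      by (simp add: bary_fmap bary_fmap_funpow Alphabet_def e e(2)[unfolded One_nat_def])
        (simp add: algebra_simps)
    moreover have "bary 0 (fmap lam 0 ((fmap lam 1 ^^ (k - 1)) q)) = d * lam ^ k - lam * lam ^ k + 1 - lam"
      by (simp add: bary_fmap bary_fmap_funpow Alphabet_def q q(2)[unfolded One_nat_def])
        (simp add: k' algebra_simps)
    ultimately show "bary 0 (fmap lam 1 ((fmap lam 0 ^^ k) e))
      = bary 0 (fmap lam 0 ((fmap lam 1 ^^ (k - 1)) q))" using d by simp
    have "bary 1 (fmap lam 1 ((fmap lam 0 ^^ k) e)) = (lam * e1) * lam ^ k + 1 - lam"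
      by (simp add: bary_fmap bary_fmap_funpow Alphabet_def e e(2)[unfolded One_nat_def])
    also have "\<dots> = (lam * lam ^ k + d * lam ^ k - lam ^ k) / 2 + 1 - lam"
      unfolding le by (simp add: field_simps)
    finally have l: "bary 1 (fmap lam 1 ((fmap lam 0 ^^ k) e))
      = (lam * lam ^ k + d * lam ^ k - lam ^ k) / 2 + 1 - lam" .
    have "bary 1 (fmap lam 0 ((fmap lam 1 ^^ (k - 1)) q)) = (lam * lam ^ k - d * lam ^ k - lam ^ k) / 2 + lam"
      by (simp add: bary_fmap bary_fmap_funpow Alphabet_def q q(2)[unfolded One_nat_def])
        (simp add: k' field_simps)
    then show "bary 1 (fmap lam 1 ((fmap lam 0 ^^ k) e))
      = bary 1 (fmap lam 0 ((fmap lam 1 ^^ (k - 1)) q))" using d l by (simp add: field_simps)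
  qed
  moreover have "fword lam (0 # replicate (k - 1) 1) q \<notin> ?S"
    by (rule hole_images_disjoint[OF lam' tss])
      (use q d' lam in \<open>auto simp: Alphabet_def set_replicate_conv_if\<close>)
  ultimately show False by (simp add: fword_replicate)
qed

text \<open>With \<open>T\<close> and \<open>d\<close> as before, the overlap is bounded inside \<open>T\<close> by the line where the
  coordinate \<open>1\<close> of \<open>T\<close> equals \<open>1 - d\<close>.  This line carries an edge of \<open>f 1 (Tri)\<close>.  Its point
  with equal coordinates \<open>0\<close> and \<open>2\<close>, namely \<open>d / 2\<close>, is in the central hole if
  \<open>d < 2 * (1 - lam)\<close>.\<close>

lemma boundary_edge_crosses_hole:
  assumes lam: "1/2 < lam" "lam < 2/3"
    and k: "k \<ge> 1" "lam ^ (k + 1) < 2 * lam - 1" "2 * lam - 1 < lam ^ k"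
    and cross: "2 * lam - 1 < 2 * (1 - lam) * lam ^ k"
  shows "\<not> totally_self_similar lam"
proof
  assume tss: "totally_self_similar lam"
  let ?S = "invariant_set lam"
  have lam': "0 < lam" "lam < 1" using lam by auto
  note S = is_invariant_invariant_set[OF lam']
  define d where "d = (2 * lam - 1) / lam ^ k"
  have pos: "lam ^ k > 0" using lam by simp
  have d: "d * lam ^ k = 2 * lam - 1" unfolding d_def using pos by (metis less_irrefl nonzero_eq_divide_eq)
  have d': "lam < d" "d < 1" "d < 2 * (1 - lam)"
    unfolding d_def using k cross pos by (simp_all add: pos_less_divide_eq pos_divide_less_eq)
  obtain q where q: "bary 0 q = d / 2" "bary 1 q = 1 - d" "bary 2 q = d / 2"
    by (rule obtain_bary[of "d / 2" "1 - d" "d / 2"]) auto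
  \<comment> \<open>The last coordinate of the same point with respect to \<open>f 1 (Tri)\<close>.\<close>
  define e2 where "e2 = d * lam ^ k / (2 * lam)"
  have e2: "0 \<le> e2" "e2 \<le> 1" using lam by (auto simp: e2_def d field_simps)
  obtain e where e: "bary 0 e = 1 - e2" "bary 1 e = 0" "bary 2 e = e2"
    by (rule obtain_bary[of "1 - e2" 0 e2]) auto
  have "e \<in> ?S"
    by (rule edge_subset_invariant_set[OF lam(1) lam'(2) S, where i = 1])
      (use e e2 in \<open>auto simp: Alphabet_def\<close>)
  then have "fmap lam 1 e \<in> ?S"
    by (intro fmap_invariant_set[OF S]) (auto simp: Alphabet_def)
  moreover have "fmap lam 1 e = fmap lam 0 ((fmap lam 1 ^^ (k - 1)) q)"
  proof (rule bary_eqI)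
    have k': "lam ^ k = lam * lam ^ (k - 1)" using k(1) by (cases k) auto
    have le: "lam * e2 = d * lam ^ k / 2" using lam by (simp add: e2_def)
    have "bary 0 (fmap lam 1 e) = lam - d * lam ^ k / 2"
      using le by (simp add: bary_fmap Alphabet_def e right_diff_distrib)
    moreover have "bary 0 (fmap lam 0 ((fmap lam 1 ^^ (k - 1)) q)) = d * lam ^ k / 2 + 1 - lam"
      by (simp add: bary_fmap bary_fmap_funpow Alphabet_def q q(2)[unfolded One_nat_def])
        (simp add: k' algebra_simps)
    ultimately show "bary 0 (fmap lam 1 e)
      = bary 0 (fmap lam 0 ((fmap lam 1 ^^ (k - 1)) q))" using d by linarith
    have "bary 1 (fmap lam 1 e) = 1 - lam"
      by (simp add: bary_fmap Alphabet_def e e(2)[unfolded One_nat_def])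
    moreover have "bary 1 (fmap lam 0 ((fmap lam 1 ^^ (k - 1)) q)) = lam - d * lam ^ k"
      by (simp add: bary_fmap bary_fmap_funpow Alphabet_def q q(2)[unfolded One_nat_def])
        (simp add: k' algebra_simps)
    ultimately show "bary 1 (fmap lam 1 e)
      = bary 1 (fmap lam 0 ((fmap lam 1 ^^ (k - 1)) q))" using d by simp
  qed
  moreover have "fword lam (0 # replicate (k - 1) 1) q \<notin> ?S"
    by (rule hole_images_disjoint[OF lam' tss])
      (use q d' lam in \<open>auto simp: Alphabet_def set_replicate_conv_if\<close>)
  ultimately show False by (simp add: fword_replicate)
qed

section \<open>Covered holes\<close>

text \<open>For a point of \<open>Tri\<close>, this describes the image of the central hole under the \<open>n\<close>-th iterate
  of a single contraction, where \<open>a\<close> and \<open>b\<close> are the coordinates of the point at the two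
  vertices that the contraction does not fix.  The last inequality bounds the third coordinate.\<close>

definition corner_hole :: "real \<Rightarrow> nat \<Rightarrow> real \<Rightarrow> real \<Rightarrow> bool" where
  "corner_hole lam n a b \<longleftrightarrow>
     a < lam ^ n * (1 - lam) \<and> b < lam ^ n * (1 - lam) \<and> lam ^ Suc n < a + b"

definition off_corner_holes :: "real \<Rightarrow> real \<Rightarrow> real \<Rightarrow> real \<Rightarrow> bool" where
  "off_corner_holes lam x y z \<longleftrightarrow> 0 \<le> x \<and> 0 \<le> y \<and> 0 \<le> z \<and> x + y + z = 1 \<and>
     (\<forall>n. \<not> corner_hole lam n y z \<and> \<not> corner_hole lam n x z \<and> \<not> corner_hole lam n x y)"

lemma corner_hole_commute: "corner_hole lam n a b \<longleftrightarrow> corner_hole lam n b a"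
  by (auto simp: corner_hole_def add.commute)

lemma off_corner_holes_swap:
  "off_corner_holes lam x y z \<longleftrightarrow> off_corner_holes lam y x z"
  "off_corner_holes lam x y z \<longleftrightarrow> off_corner_holes lam x z y"
  unfolding off_corner_holes_def using corner_hole_commute by (auto simp: add_ac)

lemma corner_hole_scale:
  assumes "lam > 0"
  shows "corner_hole lam n (a / lam) (b / lam) \<longleftrightarrow> corner_hole lam (Suc n) a b"
  using assms by (simp add: corner_hole_def field_simps)

text \<open>The bounds for one coordinate alone confine a hole to a strip parallel to an edge.\<close>

lemma corner_hole_height:
  assumes "lam > 0" "corner_hole lam n a b"
  shows "lam ^ n * (2 * lam - 1) < b" "b < lam ^ n * (1 - lam)"
  using assms by (auto simp: corner_hole_def algebra_simps)

text \<open>The conclusion compares the top of the strip of level \<open>1\<close> with the bottom of the strip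
  of level \<open>0\<close>.  By scaling, it separates any two successive levels.\<close>

lemma level_gap:
  fixes lam :: real
  assumes "1/2 < lam" "lam < 1" "2 * lam\<^sup>2 * (1 - lam) \<le> 2 * lam - 1"
  shows "lam * (1 - lam) \<le> 2 * lam - 1"
proof -
  have "0 \<le> (2 * lam - 1) * (lam * (1 - lam))" using assms by simp
  then show ?thesis using assms(3) by (simp add: algebra_simps power2_eq_square)
qed

text \<open>Holes of different levels along the same edge lie in disjoint strips parallel to it,
  whichever of its two end points they shrink to.\<close>

lemma corner_hole_level_unique:
  assumes lam: "0 < lam" "lam < 1" "lam * (1 - lam) \<le> 2 * lam - 1"
    and h: "corner_hole lam m a c" "corner_hole lam n b c"
  shows "m = n"
proof -
  have *: False if "m < n" "corner_hole lam m a c" "corner_hole lam n b c" for m n a b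
  proof -
    have "lam ^ n \<le> lam ^ Suc m" using that(1) lam by (intro power_decreasing) auto
    then have "lam ^ n * (1 - lam) \<le> lam ^ m * (lam * (1 - lam))"
      using mult_right_mono[of "lam ^ n" "lam ^ Suc m" "1 - lam"] lam by (simp add: mult_ac)
    also have "\<dots> \<le> lam ^ m * (2 * lam - 1)"
      using lam by (intro mult_left_mono) auto
    finally show False
      using corner_hole_height[OF _ that(2)] corner_hole_height[OF _ that(3)] lam by linarith
  qed
  show ?thesis using *[of m n a b] *[of n m b a] h by (cases m n rule: linorder_cases) auto
qed


text \<open>If the preimage under \<open>f 0\<close> is in a hole at the vertex \<open>1\<close>, the point is in the overlap
  with \<open>f 1 (Tri)\<close>: with the vertex \<open>0\<close> on the left, the hypothesis on \<open>lam\<close> says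
  exactly that the leftmost hole in question, under the word \<open>0 1\<close>, lies in the
  overlap, and the others lie further inside.  The preimage under \<open>f 1\<close> avoids all holes.  It could only be in a hole at the vertex \<open>0\<close>, at the same
  height and hence of the same level.  But two holes of the same level, under
  \<open>0 1 ... 1\<close> and \<open>1 0 ... 0\<close>, are mirror images of each other that do not touch.\<close>

lemma off_corner_holes_other_branch:
  assumes lam: "1/2 < lam" "lam < 2/3" "2 * lam\<^sup>2 * (1 - lam) \<le> 2 * lam - 1"
    and off: "off_corner_holes lam x y z" and x: "1 - lam \<le> x"
    and hole: "corner_hole lam n ((x - (1 - lam)) / lam) (z / lam)"
  shows "off_corner_holes lam (x / lam) ((y - (1 - lam)) / lam) (z / lam)"
proof -
  have lam0: "lam > 0" "lam < 1" using lam by auto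
  have nn: "0 \<le> x" "0 \<le> y" "0 \<le> z" "x + y + z = 1"
    and nh: "\<And>n. \<not> corner_hole lam n y z" "\<And>n. \<not> corner_hole lam n x z"
      "\<And>n. \<not> corner_hole lam n x y"
    using off by (auto simp: off_corner_holes_def)
  note gap = level_gap[OF lam(1) lam0(2) lam(3)]
  have hole': "corner_hole lam (Suc n) (x - (1 - lam)) z"
    using hole corner_hole_scale[OF lam0(1)] by simp
  have n: "n \<noteq> 0"
  proof
    assume "n = 0"
    then have "corner_hole lam 1 y z"
      using hole' nn by (simp add: corner_hole_def algebra_simps power2_eq_square)
    then show False using nh by blast
  qed
  have pow: "lam ^ Suc n \<le> lam\<^sup>2" using n lam0 by (intro power_decreasing) auto
  have "lam ^ Suc n * (1 - lam) \<le> lam\<^sup>2 * (1 - lam)"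
    using pow lam0 by (intro mult_right_mono) auto
  then have y: "1 - lam \<le> y" using hole' nn lam(3) by (auto simp: corner_hole_def)
  have A: False if m: "corner_hole lam m (x / lam) ((y - (1 - lam)) / lam)" for m
  proof -
    have "corner_hole lam (Suc m) x (y - (1 - lam))" using m corner_hole_scale[OF lam0(1)] by simp
    moreover have "lam ^ Suc m * (1 - lam) \<le> 1 * (1 - lam)"
      using lam0 by (intro mult_right_mono power_le_one) auto
    ultimately show False using x by (simp add: corner_hole_def)
  qed
  have B: False if m: "corner_hole lam m ((y - (1 - lam)) / lam) (z / lam)" for m
  proof -
    have "m = n" by (rule corner_hole_level_unique[OF lam0 gap m hole])
    then have hy: "corner_hole lam (Suc n) (y - (1 - lam)) z"
      using m corner_hole_scale[OF lam0(1)] by simp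
    \<comment> \<open>Level \<open>n = 1\<close> is special, as the hole under \<open>0 1\<close> is to the left of its mirror
      image, whereas for higher levels the two have passed each other.\<close>
    show False
    proof (cases "n = 1")
      case True
      have "z < lam\<^sup>2 * (1 - lam)" "lam ^ 3 < x - (1 - lam) + z" "lam ^ 3 < y - (1 - lam) + z"
        using hole' hy True by (auto simp: corner_hole_def eval_nat_numeral)
      then have "3 * lam ^ 3 - lam\<^sup>2 - 2 * lam + 1 < 0"
        using nn by (simp add: algebra_simps eval_nat_numeral)
      \<comment> \<open>The expansion at \<open>3/5\<close>, near the minimum on the positive axis, shows the sign.\<close>
      moreover have "3 * lam ^ 3 - lam\<^sup>2 - 2 * lam + 1
          = 3 * (lam - 3/5)\<^sup>2 * (lam + 13/15) + lam / 25 + 8/125"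
        by (simp add: field_simps eval_nat_numeral)
      moreover have "0 \<le> 3 * (lam - 3/5)\<^sup>2 * (lam + 13/15)" using lam0 by simp
      ultimately show False using lam0 by linarith
    next
      case False
      have "lam ^ Suc n \<le> lam ^ 3" using n False lam0 by (intro power_decreasing) auto
      then have "3 * (lam ^ Suc n * (1 - lam)) \<le> 3 * (lam ^ 3 * (1 - lam))"
        using lam0 by (intro mult_left_mono mult_right_mono) auto
      also have "\<dots> = (3 * lam) * (lam\<^sup>2 * (1 - lam))" by (simp add: eval_nat_numeral)
      also have "\<dots> \<le> 2 * (lam\<^sup>2 * (1 - lam))" using lam lam0 by (intro mult_right_mono) auto
      finally have "3 * (lam ^ Suc n * (1 - lam)) \<le> 2 * lam - 1" using lam(3) by simp
      then show False using hole' hy nn by (simp add: corner_hole_def)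
    qed
  qed
  show ?thesis
    unfolding off_corner_holes_def
  proof (intro conjI allI notI)
    show "x / lam + (y - (1 - lam)) / lam + z / lam = 1"
      using nn lam0 by (simp add: field_simps)
    show False if "corner_hole lam m (x / lam) (z / lam)" for m
      using that nh corner_hole_scale[OF lam0(1)] by blast
  qed (use A B nn y lam0 in auto)
qed

text \<open>The holes of the preimage under \<open>f 0\<close> at the vertex \<open>0\<close> correspond to holes of the point
  itself.  If it meets a hole at the vertex \<open>1\<close> or \<open>2\<close>, the preimage under \<open>f 1\<close> or \<open>f 2\<close>
  replaces it.\<close>

lemma off_corner_holes_preimage:
  assumes lam: "1/2 < lam" "lam < 2/3" "2 * lam\<^sup>2 * (1 - lam) \<le> 2 * lam - 1"
    and off: "off_corner_holes lam x y z" and x: "1 - lam \<le> x"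
  shows "off_corner_holes lam ((x - (1 - lam)) / lam) (y / lam) (z / lam)
    \<or> off_corner_holes lam (x / lam) ((y - (1 - lam)) / lam) (z / lam)
    \<or> off_corner_holes lam (x / lam) (y / lam) ((z - (1 - lam)) / lam)"
proof (rule ccontr)
  assume no: "\<not> ?thesis"
  have lam0: "lam > 0" using lam by simp
  have "\<not> corner_hole lam n ((x - (1 - lam)) / lam) (z / lam)" for n
    using off_corner_holes_other_branch[OF lam off x] no by blast
  moreover have "\<not> corner_hole lam n ((x - (1 - lam)) / lam) (y / lam)" for n
    using off_corner_holes_other_branch[OF lam _ x, of z y] off no off_corner_holes_swap(2) by blast
  moreover have "\<not> corner_hole lam n (y / lam) (z / lam)" for n
    using off corner_hole_scale[OF lam0] by (auto simp: off_corner_holes_def)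
  moreover have "(x - (1 - lam)) / lam + y / lam + z / lam = 1"
    using off lam0 by (simp add: off_corner_holes_def field_simps)
  ultimately have "off_corner_holes lam ((x - (1 - lam)) / lam) (y / lam) (z / lam)"
    using off x lam0 by (simp add: off_corner_holes_def)
  then show False using no by blast
qed

lemma off_corner_holes_subset_invariant_set:
  assumes lam: "1/2 < lam" "lam < 2/3" "2 * lam\<^sup>2 * (1 - lam) \<le> 2 * lam - 1"
    and S: "is_invariant_set lam S"
    and p: "off_corner_holes lam (bary 0 p) (bary 1 p) (bary 2 p)"
  shows "p \<in> S"
proof -
  let ?X = "{p. off_corner_holes lam (bary 0 p) (bary 1 p) (bary 2 p)}"
  have lam0: "0 < lam" "lam < 1" using lam by auto
  have "?X \<subseteq> S"
  proof (rule invariant_set_coinduct[OF lam0 S])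
    show "bounded ?X"
      by (rule bounded_subset[OF bounded_bary]) (auto simp: off_corner_holes_def)
    fix p assume "p \<in> ?X"
    then have off: "off_corner_holes lam (bary 0 p) (bary 1 p) (bary 2 p)" by simp
    let ?x = "bary 0 p" and ?y = "bary 1 p" and ?z = "bary 2 p"
    have "\<not> corner_hole lam 0 ?y ?z" using off by (simp add: off_corner_holes_def)
    then have "1 - lam \<le> ?x \<or> 1 - lam \<le> ?y \<or> 1 - lam \<le> ?z"
      using sum_bary[of p] by (auto simp: corner_hole_def)
    then consider
        "off_corner_holes lam ((?x - (1 - lam)) / lam) (?y / lam) (?z / lam)"
      | "off_corner_holes lam (?x / lam) ((?y - (1 - lam)) / lam) (?z / lam)"
      | "off_corner_holes lam (?x / lam) (?y / lam) ((?z - (1 - lam)) / lam)"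
      using off_corner_holes_preimage[OF lam, of ?x ?y ?z] off_corner_holes_preimage[OF lam, of ?y ?x ?z]
        off_corner_holes_preimage[OF lam, of ?z ?y ?x] off off_corner_holes_swap[of lam] by metis
    then show "\<exists>i\<in>Alphabet. \<exists>q\<in>?X. p = fmap lam i q"
    proof cases
      case 1
      obtain q where q: "p = fmap lam 0 q"
        "\<And>j. j \<in> Alphabet \<Longrightarrow> bary j q = (bary j p - (if j = 0 then 1 - lam else 0)) / lam"
        using obtain_preimage[of lam 0 p] lam0 by (auto simp: Alphabet_def)
      then have "q \<in> ?X" using 1 by (simp add: Alphabet_def)
      then show ?thesis using q(1) by (auto simp: Alphabet_def)
    next
      case 2
      obtain q where q: "p = fmap lam 1 q"
        "\<And>j. j \<in> Alphabet \<Longrightarrow> bary j q = (bary j p - (if j = 1 then 1 - lam else 0)) / lam"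
        using obtain_preimage[of lam 1 p] lam0 by (auto simp: Alphabet_def)
      then have "q \<in> ?X" using 2 by (simp add: Alphabet_def)
      then show ?thesis using q(1) by (auto simp: Alphabet_def)
    next
      case 3
      obtain q where q: "p = fmap lam 2 q"
        "\<And>j. j \<in> Alphabet \<Longrightarrow> bary j q = (bary j p - (if j = 2 then 1 - lam else 0)) / lam"
        using obtain_preimage[of lam 2 p] lam0 by (auto simp: Alphabet_def)
      then have "q \<in> ?X" using 3 by (simp add: Alphabet_def)
      then show ?thesis using q(1) by (auto simp: Alphabet_def)
    qed
  qed
  then show ?thesis using p by blast
qed

text \<open>The centre of the hole under the word \<open>0 1\<close> avoids all holes at the vertices.  It lies in
  \<open>f 0 (Tri)\<close>, hence outside the holes at the vertices \<open>1\<close> and \<open>2\<close>.  Among those at the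
  vertex \<open>0\<close>, its height only permits level \<open>2\<close>, and for that it is too far from the
  vertex.\<close>

lemma covered_hole:
  assumes lam: "1/2 < lam" "lam < 2/3" "2 * lam\<^sup>2 * (1 - lam) \<le> 2 * lam - 1"
  shows "\<not> totally_self_similar lam"
proof
  assume tss: "totally_self_similar lam"
  have lam0: "0 < lam" "lam < 1" using lam by auto
  note gap = level_gap[OF lam(1) lam0(2) lam(3)]
  obtain c where c: "bary 0 c = 1/3" "bary 1 c = 1/3" "bary 2 c = 1/3"
    by (rule obtain_bary[of "1/3" "1/3" "1/3"]) auto
  define p where "p = fmap lam 0 (fmap lam 1 c)"
  define x where "x = 1 - lam + lam\<^sup>2 / 3"
  define y where "y = lam * (1 - lam) + lam\<^sup>2 / 3"
  define z where "z = lam\<^sup>2 / 3"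
  have p: "bary 0 p = x" "bary 1 p = y" "bary 2 p = z"
    by (simp_all add: p_def bary_fmap Alphabet_def c c(2)[unfolded One_nat_def]
        x_def y_def z_def power2_eq_square algebra_simps)
  have x: "\<not> corner_hole lam n x b" for n b
  proof
    assume "corner_hole lam n x b"
    then have "x < lam ^ n * (1 - lam)" by (simp add: corner_hole_def)
    also have "\<dots> \<le> 1 * (1 - lam)"
      using lam0 by (intro mult_right_mono power_le_one) auto
    finally have "lam\<^sup>2 / 3 < 0" by (simp add: x_def)
    then show False by simp
  qed
  have y: "\<not> corner_hole lam n y z" for n
  proof
    assume h: "corner_hole lam n y z"
    have "corner_hole lam 2 z z"
      using lam lam0 by (auto simp: corner_hole_def z_def eval_nat_numeral)
    then have "n = 2" using corner_hole_level_unique[OF lam0 gap h] by blast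
    then have "y < lam * (lam * (1 - lam))"
      using h by (simp add: corner_hole_def power2_eq_square mult.assoc)
    also have "\<dots> \<le> 1 * (lam * (1 - lam))" using lam0 by (intro mult_right_mono) auto
    finally have "lam\<^sup>2 / 3 < 0" by (simp add: y_def)
    then show False by simp
  qed
  have "off_corner_holes lam x y z"
    unfolding off_corner_holes_def
  proof (intro conjI allI)
    show "0 \<le> x" "0 \<le> y" "0 \<le> z" using lam0 by (auto simp: x_def y_def z_def)
    show "x + y + z = 1"
      by (simp add: x_def y_def z_def power2_eq_square algebra_simps)
  qed (use x y in auto)
  then have "p \<in> invariant_set lam"
    using off_corner_holes_subset_invariant_set[OF lam is_invariant_invariant_set[OF lam0]] p by simp
  moreover have "fword lam [0, 1] c \<notin> invariant_set lam"
    by (rule hole_images_disjoint[OF lam0 tss]) (use c lam in \<open>auto simp: Alphabet_def\<close>)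
  ultimately show False by (simp add: p_def)
qed

section \<open>Multinacci numbers\<close>

text \<open>Multiplying the equation of the multinacci number by \<open>1 - lam\<close> gives
  \<open>lam - lam ^ (m + 1) = 1 - lam\<close>.\<close>

lemma eq_multinacciI:
  assumes lam: "0 < lam" "lam < 1" and m: "m \<ge> 1" and eq: "lam ^ (m + 1) = 2 * lam - 1"
  shows "lam = multinacci m"
proof -
  have "(1 - lam) * (\<Sum>k=1..m. lam ^ k) = lam - lam ^ Suc m"
  proof (induction m)
    case (Suc m)
    then show ?case by (simp add: distrib_left) (simp add: algebra_simps)
  qed simp
  also have "\<dots> = (1 - lam) * 1" using eq by simp
  finally have "(\<Sum>k=1..m. lam ^ k) = 1" using lam by simp
  then have "0 < lam \<and> (\<Sum>k=1..m. lam ^ k) = 1" using lam by simp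
  then show ?thesis
    unfolding multinacci_def using the1_equality[OF ex1_multinacci[OF m]] by metis
qed

text \<open>The exponents up to \<open>2\<close> are excluded by \<open>lam\<^sup>2 - (2 * lam - 1) = (1 - lam)\<^sup>2 > 0\<close>.\<close>

lemma overlap_size_between_powers:
  fixes lam :: real
  assumes lam: "1/2 < lam" "lam < 1"
    and ne: "\<And>m. m \<ge> 2 \<Longrightarrow> lam ^ (m + 1) \<noteq> 2 * lam - 1"
  obtains k where "k \<ge> 2" "lam ^ (k + 1) < 2 * lam - 1" "2 * lam - 1 < lam ^ k"
proof -
  have sq: "2 * lam - 1 < lam\<^sup>2"
  proof -
    have "0 < (1 - lam)\<^sup>2" using lam by simp
    then show ?thesis by (simp add: power2_eq_square algebra_simps)
  qed
  have ex: "\<exists>j. lam ^ j < 2 * lam - 1" using lam real_arch_pow_inv[of "2 * lam - 1" lam] by auto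
  define j where "j = (LEAST j. lam ^ j < 2 * lam - 1)"
  have j: "lam ^ j < 2 * lam - 1" unfolding j_def by (rule LeastI_ex[OF ex])
  have j3: "j \<ge> 3"
  proof (rule ccontr)
    assume "\<not> j \<ge> 3"
    then have "lam\<^sup>2 \<le> lam ^ j" using lam by (intro power_decreasing) auto
    then show False using j sq by simp
  qed
  have le: "2 * lam - 1 \<le> lam ^ (j - 1)"
    using not_less_Least[of "j - 1" "\<lambda>j. lam ^ j < 2 * lam - 1"] j3 unfolding j_def[symmetric] by simp
  show ?thesis
  proof (rule that[of "j - 1"])
    show "2 \<le> j - 1" using j3 by simp
    show "lam ^ (j - 1 + 1) < 2 * lam - 1" using j j3 by simp
    have "lam ^ (j - 1) \<noteq> 2 * lam - 1"
    proof (cases "j = 3")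
      case True then show ?thesis using sq by simp
    next
      case False
      then show ?thesis using ne[of "j - 2"] j3 by (simp add: Suc_diff_Suc numeral_2_eq_2)
    qed
    then show "2 * lam - 1 < lam ^ (j - 1)" using le by simp
  qed
qed

theorem theorem5p3:
  fixes lam :: real
  assumes "1 / 2 < lam" and "lam < 2 / 3"
    and "totally_self_similar lam"
  shows "\<exists>m::nat. m \<ge> 2 \<and> lam = multinacci m"
proof (rule ccontr)
  assume no: "\<not> ?thesis"
  have lam0: "0 < lam" "lam < 1" using assms by auto
  have "lam ^ (m + 1) \<noteq> 2 * lam - 1" if "m \<ge> 2" for m
    using eq_multinacciI[OF lam0, of m] no that by force
  then obtain k where k: "k \<ge> 2" "lam ^ (k + 1) < 2 * lam - 1" "2 * lam - 1 < lam ^ k"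
    using overlap_size_between_powers[OF assms(1) lam0(2)] by blast
  have right: "2 * lam - 1 \<le> (3 * lam - 1) * lam ^ k"
    using inner_edge_crosses_hole[OF assms(1,2) _ k(2,3)] k(1) assms(3) by fastforce
  have left: "2 * (1 - lam) * lam ^ k \<le> 2 * lam - 1"
    using boundary_edge_crosses_hole[OF assms(1,2) _ k(2,3)] k(1) assms(3) by fastforce
  have "2 * (1 - lam) \<le> 3 * lam - 1"
    using order_trans[OF left right] lam0 by (simp add: mult_le_cancel_right)
  then have lam35: "3/5 \<le> lam" by simp
  have "k = 2"
  proof (rule ccontr)
    assume "k \<noteq> 2"
    then have "lam ^ k \<le> lam ^ 3" using k(1) lam0 by (intro power_decreasing) auto
    then have "(3 * lam - 1) * lam ^ k \<le> (3 * lam - 1) * lam ^ 3"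
      using assms(1) by (intro mult_left_mono) auto
    then have "0 \<le> (3 * lam - 1) * lam ^ 3 - (2 * lam - 1)" using right by simp
    \<comment> \<open>On \<open>[3/5, 2/3]\<close> the polynomial is below its chord, which is negative.\<close>
    moreover have "(3 * lam - 1) * lam ^ 3 - (2 * lam - 1)
        = (lam - 3/5) * (lam - 2/3) * (3 * lam\<^sup>2 + 14/5 * lam + 176/75) + 23/375 - 166/1125 * lam"
      by (simp add: field_simps eval_nat_numeral)
    moreover have "(lam - 3/5) * (lam - 2/3) * (3 * lam\<^sup>2 + 14/5 * lam + 176/75) \<le> 0"
      using lam35 assms(2) by (intro mult_nonpos_nonneg mult_nonneg_nonpos) auto
    ultimately show False using lam35 by linarith
  qed
  then have "2 * lam\<^sup>2 * (1 - lam) \<le> 2 * lam - 1" using left by (simp only: mult_ac)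
  then show False using covered_hole[OF assms(1,2)] assms(3) by blast
qed

end
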